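(* Let $A \in \mathbb{C}^{n\times n}$, let $k \ge 1$ be an integer and let $E_1,\dots,E_k \in \mathbb{C}^{n\times n}$. Let $f$ be analytic on and inside a contour $\Gamma$ that winds around $\mathrm{spec}(A)$ exactly once. Then $$L_f^{(k)}(A, E_1, \dots, E_k) = \frac{1}{2\pi i} \int_\Gamma \sum_{\pi \in S_k} f(\zeta)\, M_\pi(\zeta; A, E_1,\dots, E_k) \, d\zeta,$$ where $$M_\pi(\zeta; A, E_1,\dots, E_k) = (\zeta I - A)^{-1}E_{\pi(1)}(\zeta I - A)^{-1}E_{\pi(2)}(\zeta I - A)^{-1}\cdots E_{\pi(k)}(\zeta I - A)^{-1}.$$
   Context: $\mathrm{spec}(A)$ is the spectrum of $A$, $I$ is the $n\times n$ identity matrix, and $S_k$ is the symmetric group, i.e. the set of all permutations of $\{1,\dots,k\}$. For $f$ analytic on and inside a contour $\Gamma$ winding around $\mathrm{spec}(A)$ exactly once, $f(A) = \frac{1}{2\pi i}\int_\Gamma f(\zeta)(\zeta I - A)^{-1}\,d\zeta$. Fréchet derivatives: the (first-order) Fréchet derivative of the matrix function $f$ at $A$ is the unique operator $L_f^{(1)}(A,\cdot) = L_f(A,\cdot):\mathbb{C}^{n\times n}\to\mathbb{C}^{n\times n}$ that is linear in its second argument and satisfies $f(A+E)-f(A)-L_f(A,E) = o(\|E\|)$ as $\|E\|\to 0$ (any matrix norm). For $k\ge 2$ the $k$th-order Fréchet derivative $L_f^{(k)}(A,\cdot,\dots,\cdot)$ is recursively defined as the unique multilinear function of $E_1,\dots,E_k$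 satisfying $$L_f^{(k-1)}(A+E_k,E_1,\dots,E_{k-1}) - L_f^{(k-1)}(A,E_1,\dots,E_{k-1}) - L_f^{(k)}(A,E_1,\dots,E_k) = o(\|E_k\|).$$ *)

theory Defs
  imports "HOL-Complex_Analysis.Complex_Analysis" "HOL-Combinatorics.Permutations"
    "HOL-Library.Landau_Symbols"
begin

type_synonym 'n cmatrix = "complex ^ 'n ^ 'n"

definition cscale :: "complex \<Rightarrow> 'n::finite cmatrix \<Rightarrow> 'n cmatrix" where
  "cscale c M = (\<chi> i j. c * M $ i $ j)"

definition spec :: "'n::finite cmatrix \<Rightarrow> complex set" where
  "spec A = {z. \<not> invertible (mat z - A)}"

definition resolvent :: "'n::finite cmatrix \<Rightarrow> complex \<Rightarrow> 'n cmatrix" where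
  "resolvent A z = matrix_inv (mat z - A)"

text \<open>Matrix-valued contour integrals are taken entrywise.\<close>

definition matrix_contour_integral ::
  "(real \<Rightarrow> complex) \<Rightarrow> (complex \<Rightarrow> 'n::finite cmatrix) \<Rightarrow> 'n cmatrix" where
  "matrix_contour_integral \<Gamma> F = (\<chi> i j. contour_integral \<Gamma> (\<lambda>z. F z $ i $ j))"

definition winds_once_around :: "(real \<Rightarrow> complex) \<Rightarrow> complex set \<Rightarrow> bool" where
  "winds_once_around \<Gamma> S \<longleftrightarrow>
     valid_path \<Gamma> \<and> pathfinish \<Gamma> = pathstart \<Gamma> \<and> path_image \<Gamma> \<inter> S = {} \<and>
     (\<forall>z\<in>S. winding_number \<Gamma> z = 1)"

definition analytic_on_and_inside :: "(complex \<Rightarrow> complex) \<Rightarrow> (real \<Rightarrow> complex) \<Rightarrow> bool" where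
  "analytic_on_and_inside f \<Gamma> \<longleftrightarrow> f analytic_on (path_image \<Gamma> \<union> inside (path_image \<Gamma>))"

text \<open>By the residue theorem, the integral below has the same value for every admissible
  contour, so the description is unique whenever there is an admissible contour. Where there is
  none, the value is unspecified.\<close>

definition matrix_fun :: "(complex \<Rightarrow> complex) \<Rightarrow> 'n::finite cmatrix \<Rightarrow> 'n cmatrix" where
  "matrix_fun f A = (THE F. \<exists>\<Gamma>. winds_once_around \<Gamma> (spec A) \<and> analytic_on_and_inside f \<Gamma> \<and>
     F = cscale (1 / (2 * pi * \<i>))
           (matrix_contour_integral \<Gamma> (\<lambda>z. cscale (f z) (resolvent A z))))"

text \<open>A function of \<open>k\<close> matrices takes a sequence \<open>E\<close>, of which only \<open>E 1, \<dots>, E k\<close> are relevant.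
  Linearity is over the complex numbers.\<close>

definition multilinear :: "nat \<Rightarrow> ((nat \<Rightarrow> 'n::finite cmatrix) \<Rightarrow> 'n cmatrix) \<Rightarrow> bool" where
  "multilinear k L \<longleftrightarrow>
     (\<forall>E E'. (\<forall>i\<in>{1..k}. E i = E' i) \<longrightarrow> L E = L E') \<and>
     (\<forall>i\<in>{1..k}. \<forall>E. Vector_Spaces.linear cscale cscale (\<lambda>X. L (E(i := X))))"

text \<open>The recursion starts at order 0, with the function itself, so that its first step is the
  definition of the first Frechet derivative. A derivative of order \<open>k + 1\<close> at \<open>A\<close> needs the
  derivative of order \<open>k\<close> at all points near \<open>A\<close>. The matrix \<open>H\<close> is in the role of \<open>E (k + 1)\<close>.\<close>

primrec has_frechet_deriv ::
  "nat \<Rightarrow> ('n::finite cmatrix \<Rightarrow> 'n cmatrix) \<Rightarrow> 'n cmatrix \<Rightarrow>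
   ((nat \<Rightarrow> 'n cmatrix) \<Rightarrow> 'n cmatrix) \<Rightarrow> bool" where
  "has_frechet_deriv 0 F A L \<longleftrightarrow> L = (\<lambda>_. F A)"
| "has_frechet_deriv (Suc k) F A L \<longleftrightarrow>
     multilinear (Suc k) L \<and>
     (\<exists>G. (\<forall>\<^sub>F B in nhds A. has_frechet_deriv k F B (G B)) \<and>
          (\<forall>E. (\<lambda>H. norm (G (A + H) E - G A E - L (E(Suc k := H)))) \<in> o[at 0](norm)))"

definition frechet_deriv ::
  "nat \<Rightarrow> ('n::finite cmatrix \<Rightarrow> 'n cmatrix) \<Rightarrow> 'n cmatrix \<Rightarrow>
   (nat \<Rightarrow> 'n cmatrix) \<Rightarrow> 'n cmatrix" where
  "frechet_deriv k F A = (THE L. has_frechet_deriv k F A L)"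

text \<open>\<open>resolvent_prod A z E k\<close> is \<open>R E\<^sub>1 R E\<^sub>2 R \<dots> E\<^sub>k R\<close> for \<open>R = resolvent A z\<close>.\<close>

primrec resolvent_prod ::
  "'n::finite cmatrix \<Rightarrow> complex \<Rightarrow> (nat \<Rightarrow> 'n cmatrix) \<Rightarrow> nat \<Rightarrow> 'n cmatrix" where
  "resolvent_prod A z E 0 = resolvent A z"
| "resolvent_prod A z E (Suc k) = resolvent_prod A z E k ** E (Suc k) ** resolvent A z"

definition M_perm ::
  "nat \<Rightarrow> (nat \<Rightarrow> nat) \<Rightarrow> complex \<Rightarrow> 'n::finite cmatrix \<Rightarrow> (nat \<Rightarrow> 'n cmatrix) \<Rightarrow> 'n cmatrix" where
  "M_perm k \<pi> z A E = resolvent_prod A z (\<lambda>i. E (\<pi> i)) k"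

end

theory Submission
  imports Defs
begin

text \<open>
  By the contour integral formula for \<open>f(A)\<close>, the matrix enters only through the resolvent
  \<open>R = (z I - A)\<^sup>-\<^sup>1\<close>, whose derivative in the direction \<open>H\<close> is \<open>R H R\<close>. Differentiating
  the product \<open>R E\<^sub>1 R \<dots> E\<^sub>k R\<close> once more therefore inserts \<open>H\<close> at each of the \<open>k + 1\<close>
  possible places. Summed over all orderings of \<open>E\<^sub>1, \<dots>, E\<^sub>k\<close> these insertions are all orderings
  of \<open>E\<^sub>1, \<dots>, E\<^sub>k, H\<close>, so the formula of order \<open>k\<close> differentiates to the formula of order \<open>k + 1\<close>
  (\<open>perm_sum_Suc\<close>), and the theorem follows by induction on \<open>k\<close>.

  Four points need care. A derivative of higher order at \<open>A\<close> presupposes lower derivatives at all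
  nearby matrices, so the induction treats all matrices that the fixed contour is admissible for at
  once; they form an open set because the spectrum is upper semicontinuous
  (\<open>spec_upper_semicontinuous\<close>, \<open>eventually_winds_once_around_spec\<close>). The function \<open>f(A)\<close> is
  described through any admissible contour, and the residue theorem shows that the integral over
  each of them is the same sum of residues at the eigenvalues, which are finite in number
  (\<open>matrix_integral_eq_residues\<close>). Differentiation under the integral rests on a
  remainder that is quadratic in \<open>H\<close> uniformly on a neighbourhood of the contour
  (\<open>resolvent_prod_taylor\<close>, \<open>perm_integral_step\<close>). Finally, the derivative is denoted by a
  description, and \<open>has_frechet_deriv_unique\<close> identifies it with the integral.
\<close>

(* The symbol also denotes coefficients of power series, which makes every matrix entry ambiguous. *)
no_notation fps_nth (infixl "$" 75)


section \<open>Matrix algebra\<close>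

text \<open>The norm of a matrix as a vector of vectors is the Frobenius norm, and Cauchy-Schwarz makes it
  submultiplicative.\<close>

lemma norm_matrix_matrix_mult_le:
  fixes X Y :: "'n::finite cmatrix"
  shows "norm (X ** Y) \<le> norm X * norm Y"
proof -
  have sq: "(norm Z)\<^sup>2 = (\<Sum>i\<in>UNIV. \<Sum>j\<in>UNIV. (cmod (Z $ i $ j))\<^sup>2)" for Z :: "'n cmatrix"
    by (simp add: norm_vec_def L2_set_def sum_nonneg)
  have entry: "(cmod ((X ** Y) $ i $ j))\<^sup>2
      \<le> (\<Sum>k\<in>UNIV. (cmod (X $ i $ k))\<^sup>2) * (\<Sum>k\<in>UNIV. (cmod (Y $ k $ j))\<^sup>2)" for i j
  proof -
    have "cmod ((X ** Y) $ i $ j) \<le> (\<Sum>k\<in>UNIV. \<bar>cmod (X $ i $ k)\<bar> * \<bar>cmod (Y $ k $ j)\<bar>)"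
      unfolding matrix_matrix_mult_def by (simp add: sum_norm_le norm_mult)
    also have "\<dots> \<le> L2_set (\<lambda>k. cmod (X $ i $ k)) UNIV * L2_set (\<lambda>k. cmod (Y $ k $ j)) UNIV"
      by (rule L2_set_mult_ineq)
    finally have "(cmod ((X ** Y) $ i $ j))\<^sup>2
        \<le> (L2_set (\<lambda>k. cmod (X $ i $ k)) UNIV * L2_set (\<lambda>k. cmod (Y $ k $ j)) UNIV)\<^sup>2"
      by (rule power_mono) simp
    then show ?thesis
      by (simp add: power_mult_distrib L2_set_def sum_nonneg)
  qed
  have "(norm (X ** Y))\<^sup>2 \<le> (\<Sum>i\<in>UNIV. \<Sum>j\<in>UNIV.
      (\<Sum>k\<in>UNIV. (cmod (X $ i $ k))\<^sup>2) * (\<Sum>k\<in>UNIV. (cmod (Y $ k $ j))\<^sup>2))"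
    unfolding sq by (intro sum_mono entry)
  also have "\<dots> = (norm X)\<^sup>2 * (\<Sum>j\<in>UNIV. \<Sum>k\<in>UNIV. (cmod (Y $ k $ j))\<^sup>2)"
    unfolding sq by (simp add: sum_product)
  also have "(\<Sum>j\<in>UNIV. \<Sum>k\<in>UNIV. (cmod (Y $ k $ j))\<^sup>2) = (norm Y)\<^sup>2"
    unfolding sq by (rule sum.swap)
  finally have "(norm (X ** Y))\<^sup>2 \<le> (norm X * norm Y)\<^sup>2"
    by (simp add: power_mult_distrib)
  then show ?thesis
    by (rule power2_le_imp_le) simp
qed

lemma bounded_bilinear_matrix_matrix_mult:
  "bounded_bilinear ((**) :: 'n::finite cmatrix \<Rightarrow> 'n cmatrix \<Rightarrow> 'n cmatrix)"
proof
  show "\<exists>K. \<forall>(X :: 'n cmatrix) (Y :: 'n cmatrix). norm (X ** Y) \<le> norm X * norm Y * K"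
    by (rule exI[of _ 1]) (simp add: norm_matrix_matrix_mult_le)
qed (simp_all add: vec_eq_iff matrix_matrix_mult_def
      sum.distrib algebra_simps scaleR_sum_right)

lemmas matrix_mult_add_distribs =
  bounded_bilinear.add_left[OF bounded_bilinear_matrix_matrix_mult]
  bounded_bilinear.add_right[OF bounded_bilinear_matrix_matrix_mult]
lemmas matrix_mult_diff_left = bounded_bilinear.diff_left[OF bounded_bilinear_matrix_matrix_mult]
lemmas matrix_mult_diff_right = bounded_bilinear.diff_right[OF bounded_bilinear_matrix_matrix_mult]
lemmas matrix_mult_sum_left = bounded_bilinear.sum_left[OF bounded_bilinear_matrix_matrix_mult]

lemma norm_matrix_le_sum_entries:
  fixes X :: "'n::finite cmatrix"
  shows "norm X \<le> (\<Sum>i\<in>UNIV. \<Sum>j\<in>UNIV. cmod (X $ i $ j))"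
proof -
  have "norm X \<le> (\<Sum>i\<in>UNIV. norm (X $ i))"
    unfolding norm_vec_def[of X] by (rule L2_set_le_sum) simp
  also have "\<dots> \<le> (\<Sum>i\<in>UNIV. \<Sum>j\<in>UNIV. cmod (X $ i $ j))"
    unfolding norm_vec_def by (intro sum_mono L2_set_le_sum) simp
  finally show ?thesis .
qed

lemma norm_entry_le: "cmod (X $ i $ j) \<le> norm (X :: 'n::finite cmatrix)"
  by (rule order_trans[OF Finite_Cartesian_Product.norm_nth_le Finite_Cartesian_Product.norm_nth_le])

lemma norm_cscale: "norm (cscale c X) = cmod c * norm X"
  unfolding cscale_def norm_vec_def
  by (simp add: norm_mult L2_set_right_distrib)

lemma cscale_of_real: "cscale (of_real t) X = t *\<^sub>R X"
  by (simp add: cscale_def vec_eq_iff scaleR_conv_of_real[where 'a = complex])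

lemma cscale_add: "cscale c (X + Y) = cscale c X + cscale c Y"
  by (simp add: cscale_def vec_eq_iff algebra_simps)

lemma cscale_diff: "cscale c (X - Y) = cscale c X - cscale c Y"
  by (simp add: cscale_def vec_eq_iff algebra_simps)

lemma cscale_cscale: "cscale a (cscale b X) = cscale (a * b) X"
  by (simp add: cscale_def vec_eq_iff algebra_simps)

lemma cscale_sum: "cscale c (\<Sum>i\<in>I. X i) = (\<Sum>i\<in>I. cscale c (X i))"
  by (simp add: cscale_def vec_eq_iff sum_distrib_left)

lemma cscale_mult_left: "cscale c X ** Y = cscale c (X ** Y)"
  by (simp add: cscale_def vec_eq_iff matrix_matrix_mult_def sum_distrib_left algebra_simps)

lemma cscale_mult_right: "X ** cscale c Y = cscale c (X ** Y)"
  by (simp add: cscale_def vec_eq_iff matrix_matrix_mult_def sum_distrib_left algebra_simps)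

lemma vector_space_cscale: "vector_space cscale"
  by unfold_locales (simp_all add: cscale_def vec_eq_iff algebra_simps)

lemma linear_cscaleI:
  assumes "\<And>X Y. g (X + Y) = g X + g Y" and "\<And>c X. g (cscale c X) = cscale c (g X)"
  shows "Vector_Spaces.linear cscale cscale g"
  using assms by (simp add: Vector_Spaces.linear_iff vector_space_cscale)

section \<open>The resolvent as a function of the matrix and the point\<close>

lemma continuous_on_det:
  fixes M :: "'a::topological_space \<Rightarrow> 'n::finite cmatrix"
  assumes "\<And>i j. continuous_on S (\<lambda>x. M x $ i $ j)"
  shows "continuous_on S (\<lambda>x. det (M x))"
  unfolding det_def by (intro continuous_intros assms)

lemma holomorphic_on_det:
  fixes M :: "complex \<Rightarrow> 'n::finite cmatrix"
  assumes "\<And>i j. (\<lambda>x. M x $ i $ j) holomorphic_on S"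
  shows "(\<lambda>x. det (M x)) holomorphic_on S"
  unfolding det_def by (intro holomorphic_intros assms)

lemma
  fixes M :: "'a::semiring_1^'n^'m"
  assumes "invertible M"
  shows matrix_inv_right: "M ** matrix_inv M = mat 1"
    and matrix_inv_left: "matrix_inv M ** M = mat 1"
  using assms someI_ex[of "\<lambda>N. M ** N = mat 1 \<and> N ** M = mat 1"]
  unfolding matrix_inv_def invertible_def by auto

text \<open>By Cramer's rule the entries of the inverse are quotients of determinants. Joint continuity of
  the resolvent in the matrix and the point, and holomorphy in the point, are read off from here.\<close>

lemma matrix_inv_entry:
  fixes M :: "'n::finite cmatrix"
  assumes "invertible M"
  shows "matrix_inv M $ i $ j
    = det (\<chi> p q. if q = i then (if p = j then 1 else 0) else M $ p $ q) / det M"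
proof -
  have "det M \<noteq> 0"
    using assms by (simp add: invertible_det_nz)
  moreover have "M *v column j (matrix_inv M) = (\<chi> p. if p = j then 1 else 0)"
    using matrix_inv_right[OF assms]
    by (simp add: vec_eq_iff matrix_vector_mult_def matrix_matrix_mult_def column_def mat_def)
  ultimately have "column j (matrix_inv M)
      = (\<chi> i. det (\<chi> p q. if q = i then (\<chi> p. if p = j then 1 else 0) $ p else M $ p $ q) / det M)"
    by (rule iffD1[OF cramer])
  then have "column j (matrix_inv M) $ i
      = det (\<chi> p q. if q = i then (if p = j then 1 else 0) else M $ p $ q) / det M"
    by (simp only: vec_lambda_beta)
  then show ?thesis
    by (simp add: column_def)
qed

lemma continuous_on_mat_diff_entry:
  "continuous_on S (\<lambda>p :: 'n::finite cmatrix \<times> complex. (mat (snd p) - fst p) $ i $ j)"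
  by (cases "i = j") (auto simp: mat_def intro!: continuous_intros)

lemma holomorphic_on_mat_diff_entry: "(\<lambda>z. (mat z - B) $ i $ j) holomorphic_on S"
  by (cases "i = j") (auto simp: mat_def intro!: holomorphic_intros)

text \<open>The domain of the resolvent in both arguments together. It is kept as one set of pairs, with the
  matrix first, because the tube lemma is applied to it: what holds at one matrix for all points of
  a compact set persists for all nearby matrices.\<close>

definition regular_pairs :: "('n::finite cmatrix \<times> complex) set" where
  "regular_pairs = {(B, z). z \<notin> spec B}"

lemma regular_pairs_iff: "(B, z) \<in> regular_pairs \<longleftrightarrow> z \<notin> spec B"
  by (simp add: regular_pairs_def)

lemma spec_iff_det: "z \<in> spec B \<longleftrightarrow> det (mat z - B) = 0"
  by (simp add: spec_def invertible_det_nz)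

lemma open_regular_pairs: "open (regular_pairs :: ('n::finite cmatrix \<times> complex) set)"
proof -
  have "continuous_on UNIV (\<lambda>p :: 'n cmatrix \<times> complex. det (mat (snd p) - fst p))"
    by (intro continuous_on_det continuous_on_mat_diff_entry)
  then have "open ((\<lambda>p :: 'n cmatrix \<times> complex. det (mat (snd p) - fst p)) -` (- {0}))"
    by (intro open_vimage) auto
  also have "(\<lambda>p :: 'n cmatrix \<times> complex. det (mat (snd p) - fst p)) -` (- {0}) = regular_pairs"
    by (auto simp: regular_pairs_def spec_iff_det)
  finally show ?thesis .
qed

lemma resolvent_entry:
  assumes "z \<notin> spec B"
  shows "resolvent B z $ i $ j =
    det (\<chi> p q. if q = i then (if p = j then 1 else 0) else (mat z - B) $ p $ q) / det (mat z - B)"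
  unfolding resolvent_def by (rule matrix_inv_entry) (use assms in \<open>simp add: spec_def\<close>)

lemma continuous_on_resolvent:
  "continuous_on (regular_pairs :: ('n::finite cmatrix \<times> complex) set) (\<lambda>(B, z). resolvent B z)"
proof -
  have entry: "continuous_on (regular_pairs :: ('n cmatrix \<times> complex) set)
      (\<lambda>(B, z). resolvent B z $ i $ j)" for i j
  proof -
    have "continuous_on (regular_pairs :: ('n cmatrix \<times> complex) set)
      (\<lambda>(B, z). det (\<chi> p q. if q = i then (if p = j then 1 else 0) else (mat z - B) $ p $ q)
        / det (mat z - B))"
      unfolding case_prod_beta
    proof (intro continuous_on_divide continuous_on_det continuous_on_mat_diff_entry)
      show "\<forall>p\<in>regular_pairs. det (mat (snd p) - fst p :: 'n cmatrix) \<noteq> 0"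
        by (auto simp: regular_pairs_def spec_iff_det)
      show "continuous_on regular_pairs (\<lambda>pz :: 'n cmatrix \<times> complex. (\<chi> p q. if q = i
          then (if p = j then 1 else 0) else (mat (snd pz) - fst pz) $ p $ q) $ r $ s)" for r s
        by (cases "s = i") (simp_all add: continuous_on_mat_diff_entry del: vector_minus_component)
    qed
    then show ?thesis
      by (rule continuous_on_eq) (auto simp: regular_pairs_def resolvent_entry)
  qed
  have "continuous_on (regular_pairs :: ('n cmatrix \<times> complex) set)
      (\<lambda>p. \<chi> i j. resolvent (fst p) (snd p) $ i $ j)"
    using entry by (intro continuous_on_vec_lambda) (simp add: case_prod_beta)
  then show ?thesis
    by (simp add: case_prod_beta)
qed

section \<open>Matrix-valued holomorphic functions and their contour integrals\<close>

definition matrix_holomorphic_on :: "(complex \<Rightarrow> 'n::finite cmatrix) \<Rightarrow> complex set \<Rightarrow> bool" where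
  "matrix_holomorphic_on F S \<longleftrightarrow> (\<forall>i j. (\<lambda>z. F z $ i $ j) holomorphic_on S)"

lemma matrix_holomorphic_on_resolvent:
  "matrix_holomorphic_on (resolvent B) (- spec B)"
  unfolding matrix_holomorphic_on_def
proof (intro allI)
  fix i j
  have "(\<lambda>z. det (\<chi> p q. if q = i then (if p = j then 1 else 0) else (mat z - B) $ p $ q)
      / det (mat z - B)) holomorphic_on - spec B"
  proof (intro holomorphic_on_divide holomorphic_on_det holomorphic_on_mat_diff_entry)
    show "\<And>z. z \<in> - spec B \<Longrightarrow> det (mat z - B) \<noteq> 0"
      by (simp add: spec_iff_det)
    show "(\<lambda>z. (\<chi> p q. if q = i then (if p = j then 1 else 0) else (mat z - B) $ p $ q) $ r $ s)
        holomorphic_on - spec B" for r s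
      by (cases "s = i") (simp_all add: holomorphic_on_mat_diff_entry del: vector_minus_component)
  qed
  then show "(\<lambda>z. resolvent B z $ i $ j) holomorphic_on - spec B"
    by (rule holomorphic_transform) (simp add: resolvent_entry)
qed

lemma matrix_holomorphic_on_subset:
  "matrix_holomorphic_on F S \<Longrightarrow> T \<subseteq> S \<Longrightarrow> matrix_holomorphic_on F T"
  unfolding matrix_holomorphic_on_def using holomorphic_on_subset by blast

lemma matrix_holomorphic_on_const: "matrix_holomorphic_on (\<lambda>_. X) S"
  by (simp add: matrix_holomorphic_on_def)

lemma matrix_holomorphic_on_mult:
  "matrix_holomorphic_on F S \<Longrightarrow> matrix_holomorphic_on G S
    \<Longrightarrow> matrix_holomorphic_on (\<lambda>z. F z ** G z) S"
  by (auto simp: matrix_holomorphic_on_def matrix_matrix_mult_def intro!: holomorphic_intros)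

lemma matrix_holomorphic_on_cscale:
  "g holomorphic_on S \<Longrightarrow> matrix_holomorphic_on F S
    \<Longrightarrow> matrix_holomorphic_on (\<lambda>z. cscale (g z) (F z)) S"
  by (auto simp: matrix_holomorphic_on_def cscale_def intro!: holomorphic_intros)

lemma matrix_holomorphic_on_diff:
  "matrix_holomorphic_on F S \<Longrightarrow> matrix_holomorphic_on G S
    \<Longrightarrow> matrix_holomorphic_on (\<lambda>z. F z - G z) S"
  by (auto simp: matrix_holomorphic_on_def intro!: holomorphic_intros)

lemma matrix_holomorphic_on_sum:
  "(\<And>a. a \<in> I \<Longrightarrow> matrix_holomorphic_on (F a) S)
    \<Longrightarrow> matrix_holomorphic_on (\<lambda>z. \<Sum>a\<in>I. F a z) S"
  by (auto simp: matrix_holomorphic_on_def intro!: holomorphic_intros)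

lemma matrix_holomorphic_on_resolvent_prod:
  assumes "S \<inter> spec B = {}"
  shows "matrix_holomorphic_on (\<lambda>z. resolvent_prod B z E k) S"
proof -
  have R: "matrix_holomorphic_on (resolvent B) S"
    using matrix_holomorphic_on_resolvent assms by (blast intro: matrix_holomorphic_on_subset)
  show ?thesis
    by (induction k) (use R in \<open>auto intro!: matrix_holomorphic_on_mult matrix_holomorphic_on_const\<close>)
qed

context
  fixes \<Gamma> :: "real \<Rightarrow> complex" and S :: "complex set"
  assumes \<Gamma>: "valid_path \<Gamma>" "path_image \<Gamma> \<subseteq> S" and S: "open S"
begin

lemma matrix_holomorphic_imp_integrable:
  "matrix_holomorphic_on F S \<Longrightarrow> (\<lambda>z. F z $ i $ j) contour_integrable_on \<Gamma>"
  unfolding matrix_holomorphic_on_def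
  using contour_integrable_holomorphic_simple[OF _ S \<Gamma>] by blast

lemma matrix_contour_integral_add:
  "matrix_holomorphic_on F S \<Longrightarrow> matrix_holomorphic_on G S \<Longrightarrow>
    matrix_contour_integral \<Gamma> (\<lambda>z. F z + G z)
      = matrix_contour_integral \<Gamma> F + matrix_contour_integral \<Gamma> G"
  by (simp add: matrix_contour_integral_def vec_eq_iff contour_integral_add
      matrix_holomorphic_imp_integrable)

lemma matrix_contour_integral_diff:
  "matrix_holomorphic_on F S \<Longrightarrow> matrix_holomorphic_on G S \<Longrightarrow>
    matrix_contour_integral \<Gamma> (\<lambda>z. F z - G z)
      = matrix_contour_integral \<Gamma> F - matrix_contour_integral \<Gamma> G"
  by (simp add: matrix_contour_integral_def vec_eq_iff contour_integral_diff
      matrix_holomorphic_imp_integrable)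

lemma matrix_contour_integral_cscale:
  "matrix_holomorphic_on F S \<Longrightarrow>
    matrix_contour_integral \<Gamma> (\<lambda>z. cscale c (F z)) = cscale c (matrix_contour_integral \<Gamma> F)"
  by (simp add: matrix_contour_integral_def cscale_def vec_eq_iff contour_integral_lmul
      matrix_holomorphic_imp_integrable)

text \<open>The velocity of a piecewise continuously differentiable path may be unbounded near a break point,
  so there need be no estimate by the supremum over the path alone. For integrands that are
  holomorphic on a fixed neighbourhood of the path there is one by the supremum over that
  neighbourhood, as the path can be replaced by a polynomial path inside it.\<close>

lemma matrix_contour_integral_bound:
  obtains L where "L > 0"
    and "\<And>(F :: complex \<Rightarrow> 'n::finite cmatrix) b. matrix_holomorphic_on F S
          \<Longrightarrow> (\<And>z. z \<in> S \<Longrightarrow> norm (F z) \<le> b) \<Longrightarrow> norm (matrix_contour_integral \<Gamma> F) \<le> L * b"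
proof -
  obtain L where L: "L > 0" and bound: "\<And>g b. g holomorphic_on S \<Longrightarrow> (\<forall>z\<in>S. cmod (g z) \<le> b)
      \<Longrightarrow> cmod (contour_integral \<Gamma> g) \<le> L * b"
    using contour_integral_bound_exists[OF S \<Gamma>] by blast
  show ?thesis
  proof
    show "real (CARD('n) * CARD('n)) * L > 0"
      using L by simp
    fix F :: "complex \<Rightarrow> 'n cmatrix" and b
    assume F: "matrix_holomorphic_on F S" and b: "\<And>z. z \<in> S \<Longrightarrow> norm (F z) \<le> b"
    have "norm (matrix_contour_integral \<Gamma> F)
        \<le> (\<Sum>i\<in>UNIV. \<Sum>j\<in>UNIV. cmod (matrix_contour_integral \<Gamma> F $ i $ j))"
      by (rule norm_matrix_le_sum_entries)
    also have "\<dots> \<le> (\<Sum>i\<in>(UNIV::'n set). \<Sum>j\<in>(UNIV::'n set). L * b)"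
    proof (intro sum_mono)
      fix i j
      show "cmod (matrix_contour_integral \<Gamma> F $ i $ j) \<le> L * b"
        using bound[of "\<lambda>z. F z $ i $ j" b] F order_trans[OF norm_entry_le b]
        by (simp add: matrix_contour_integral_def matrix_holomorphic_on_def)
    qed
    finally show "norm (matrix_contour_integral \<Gamma> F) \<le> real (CARD('n) * CARD('n)) * L * b"
      by (simp add: algebra_simps)
  qed
qed

end

section \<open>The spectrum\<close>

text \<open>This is the statement that the resolvent exists near infinity, uniformly for matrices near
  \<open>A\<close>: large \<open>z\<close> correspond to small \<open>w = 1 / z\<close>, and at \<open>w = 0\<close> the determinant is 1.\<close>

lemma eventually_det_one_minus_ne_0:
  "\<forall>\<^sub>F (B, w) in nhds (A, 0). det (mat 1 - cscale w B :: 'n::finite cmatrix) \<noteq> 0"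
proof -
  have "continuous_on UNIV (\<lambda>p :: 'n cmatrix \<times> complex. det (mat 1 - cscale (snd p) (fst p)))"
    unfolding cscale_def by (rule continuous_on_det) (auto intro!: continuous_intros)
  then have "open ((\<lambda>p :: 'n cmatrix \<times> complex. det (mat 1 - cscale (snd p) (fst p))) -` (- {0}))"
    by (intro open_vimage) auto
  moreover have "det (mat 1 - cscale 0 A) \<noteq> 0"
    by (simp add: cscale_def flip: zero_vec_def)
  ultimately have "\<forall>\<^sub>F p in nhds (A, 0). det (mat 1 - cscale (snd p) (fst p)) \<noteq> 0"
    by (auto dest!: eventually_nhds_in_open[where x = "(A, 0)"])
  then show ?thesis
    by (rule eventually_mono) (simp add: case_prod_beta)
qed

lemma det_mat_minus_inverse:
  fixes B :: "'n::finite cmatrix"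
  assumes "w \<noteq> 0"
  shows "inverse w \<in> spec B \<longleftrightarrow> det (mat 1 - cscale w B) = 0"
proof -
  have "mat 1 - cscale w B = (\<chi> i. w *s (mat (inverse w) - B) $ i)"
    using assms by (auto simp: cscale_def mat_def vec_eq_iff algebra_simps)
  then have "det (mat 1 - cscale w B) = w ^ CARD('n) * det (mat (inverse w) - B)"
    using det_rows_mul[of "\<lambda>_. w" "\<lambda>i. (mat (inverse w) - B) $ i"]
    by (simp only: vec_nth_inverse prod_constant)
  then show ?thesis
    using assms by (simp add: spec_iff_det)
qed

lemma locally_bounded_spec:
  obtains R where "\<forall>\<^sub>F B in nhds A. spec B \<subseteq> cball 0 R"
proof -
  obtain P Q where P: "eventually P (nhds A)" and Q: "eventually Q (nhds (0::complex))"
    and PQ: "\<And>B w. P B \<Longrightarrow> Q w \<Longrightarrow> det (mat 1 - cscale w B) \<noteq> 0"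
    using eventually_det_one_minus_ne_0[of A] unfolding nhds_prod eventually_prod_filter by auto
  from Q obtain e where e: "e > 0" "\<And>w. cmod w < e \<Longrightarrow> Q w"
    by (auto simp: eventually_nhds_metric)
  have "spec B \<subseteq> cball 0 (1 / e)" if "P B" for B
  proof
    fix z assume z: "z \<in> spec B"
    show "z \<in> cball 0 (1 / e)"
    proof (rule ccontr)
      assume "z \<notin> cball 0 (1 / e)"
      then have big: "1 / e < cmod z"
        by simp
      then have "z \<noteq> 0"
        using e(1) by auto
      moreover from this have "cmod (inverse z) < e"
        using big e(1) by (simp add: norm_inverse inverse_eq_divide norm_divide field_simps)
      ultimately show False
        using PQ[OF that e(2)] det_mat_minus_inverse[of "inverse z" B] z by auto
    qed
  qed
  with P have "\<forall>\<^sub>F B in nhds A. spec B \<subseteq> cball 0 (1 / e)"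
    by (blast intro: eventually_mono)
  then show ?thesis
    by (rule that)
qed

text \<open>Eigenvalues of nearby matrices stay in a fixed disc. On the compact part of the disc outside
  \<open>V\<close> the matrix \<open>z I - A\<close> is invertible, and by the tube lemma so is \<open>z I - B\<close> for all \<open>B\<close> near \<open>A\<close>.\<close>

lemma spec_upper_semicontinuous:
  assumes "open V" and "spec A \<subseteq> V"
  shows "\<forall>\<^sub>F B in nhds A. spec B \<subseteq> V"
proof -
  obtain R where R: "\<forall>\<^sub>F B in nhds A. spec B \<subseteq> cball 0 R"
    by (rule locally_bounded_spec)
  have "compact (cball 0 R - V)"
    using assms(1) by (intro compact_diff) auto
  moreover have "{A} \<times> (cball 0 R - V) \<subseteq> regular_pairs"
    using assms(2) by (auto simp: regular_pairs_iff)
  ultimately have "\<exists>X. A \<in> X \<and> open X \<and> X \<times> (cball 0 R - V) \<subseteq> regular_pairs"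
    by (rule Elementary_Topology.tube_lemma[OF _ open_regular_pairs])
  then obtain X where X: "A \<in> X" "open X" "X \<times> (cball 0 R - V) \<subseteq> regular_pairs"
    by blast
  have "\<forall>\<^sub>F B in nhds A. B \<in> X"
    using X eventually_nhds by blast
  with R show ?thesis
  proof eventually_elim
    case (elim B)
    then show ?case
      using X(3) by (auto simp: regular_pairs_iff subset_iff)
  qed
qed

text \<open>The determinant commutes with the ring homomorphism that evaluates polynomials at a point; so the
  characteristic polynomial can be taken to be a determinant over the polynomial ring.\<close>

lemma poly_det:
  fixes M :: "complex poly ^ 'n ^ 'n::finite"
  shows "poly (det M) z = det (\<chi> i j. poly (M $ i $ j) z)"
  by (simp add: det_def poly_sum poly_prod)

lemma finite_spec: "finite (spec (A :: 'n::finite cmatrix))"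
proof -
  define p where "p = det (\<chi> i j. if i = j then [:- A $ i $ j, 1:] else [:- A $ i $ j:])"
  have poly_p: "poly p z = det (mat z - A)" for z
    unfolding p_def poly_det by (rule arg_cong[of _ _ det]) (simp add: vec_eq_iff mat_def)
  obtain R where "\<forall>\<^sub>F B in nhds A. spec B \<subseteq> cball 0 R"
    by (rule locally_bounded_spec)
  then have "spec A \<subseteq> cball 0 R"
    by (rule eventually_nhds_x_imp_x)
  then have "of_real (\<bar>R\<bar> + 1) \<notin> spec A"
    by (force simp del: of_real_add)
  then have "p \<noteq> 0"
    using poly_p[of "of_real (\<bar>R\<bar> + 1)"] by (auto simp: spec_iff_det)
  then have "finite {z. poly p z = 0}"
    by (rule poly_roots_finite)
  then show ?thesis
    by (simp add: poly_p flip: spec_iff_det)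
qed

lemma closed_spec: "closed (spec A)"
  by (simp add: finite_spec finite_imp_closed)

section \<open>Independence of the contour\<close>

text \<open>The residues on the right do not mention the contour, so all admissible contours give the same
  integral. A homotopy between two of them that avoids the eigenvalues and stays where \<open>f\<close> is
  analytic need not exist, for instance around a pole of \<open>f\<close> that lies outside of both; but both
  see the same germs of \<open>f\<close> at the eigenvalues.\<close>

lemma matrix_integral_eq_residues:
  fixes A :: "'n::finite cmatrix"
  assumes \<Gamma>: "winds_once_around \<Gamma> (spec A)" and f: "analytic_on_and_inside f \<Gamma>"
  shows "matrix_contour_integral \<Gamma> (\<lambda>z. cscale (f z) (resolvent A z))
    = (\<chi> i j. 2 * pi * \<i> * (\<Sum>p\<in>spec A. residue (\<lambda>z. f z * resolvent A z $ i $ j) p))"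
proof -
  let ?K = "path_image \<Gamma> \<union> inside (path_image \<Gamma>)"
  have path: "valid_path \<Gamma>" "path \<Gamma>" "pathfinish \<Gamma> = pathstart \<Gamma>"
    and disj: "path_image \<Gamma> \<inter> spec A = {}"
    and wind: "\<And>z. z \<in> spec A \<Longrightarrow> winding_number \<Gamma> z = 1"
    using \<Gamma> by (auto simp: winds_once_around_def valid_path_imp_path)
  obtain W where W: "open W" "?K \<subseteq> W" "f holomorphic_on W"
    using f unfolding analytic_on_and_inside_def analytic_on_holomorphic by blast
  \<comment> \<open>the residue theorem wants a connected domain, and the domain of analyticity need not be connected\<close>
  have "connected ?K"
    using path(2) by (intro connected_with_inside closed_path_image connected_path_image)
  obtain a where a: "a \<in> path_image \<Gamma>"
    using path_image_nonempty by blast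
  define S where "S = connected_component_set W a"
  have S: "open S" "connected S" "S \<subseteq> W"
    unfolding S_def using W(1) open_connected_component connected_component_subset by blast+
  have "?K \<subseteq> S"
    unfolding S_def using \<open>connected ?K\<close> W(2) a by (intro connected_component_maximal) auto
  have outside: "winding_number \<Gamma> z = 0" if "z \<notin> S" for z
  proof -
    have "z \<in> outside (path_image \<Gamma>)"
      using that \<open>?K \<subseteq> S\<close> outside_inside[of "path_image \<Gamma>"] by auto
    then show ?thesis
      using path by (intro winding_number_zero_in_outside)
  qed
  have "contour_integral \<Gamma> (\<lambda>z. cscale (f z) (resolvent A z) $ i $ j)
      = 2 * pi * \<i> * (\<Sum>p\<in>spec A. residue (\<lambda>z. f z * resolvent A z $ i $ j) p)" for i j
  proof -
    have "(\<lambda>z. resolvent A z $ i $ j) holomorphic_on S - spec A"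
      using matrix_holomorphic_on_resolvent[of A]
      by (auto simp: matrix_holomorphic_on_def intro: holomorphic_on_subset)
    moreover have "f holomorphic_on S - spec A"
      using W(3) S(3) by (auto intro: holomorphic_on_subset)
    ultimately have "(\<lambda>z. f z * resolvent A z $ i $ j) holomorphic_on S - spec A"
      by (intro holomorphic_intros)
    then have "contour_integral \<Gamma> (\<lambda>z. f z * resolvent A z $ i $ j)
        = 2 * pi * \<i> * (\<Sum>p\<in>spec A. winding_number \<Gamma> p * residue (\<lambda>z. f z * resolvent A z $ i $ j) p)"
      using S path \<open>?K \<subseteq> S\<close> disj outside by (intro Residue_theorem finite_spec) auto
    also have "(\<Sum>p\<in>spec A. winding_number \<Gamma> p * residue (\<lambda>z. f z * resolvent A z $ i $ j) p)
        = (\<Sum>p\<in>spec A. residue (\<lambda>z. f z * resolvent A z $ i $ j) p)"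
      using wind by (intro sum.cong) auto
    finally show ?thesis
      by (simp add: cscale_def)
  qed
  then show ?thesis
    by (simp add: matrix_contour_integral_def vec_eq_iff)
qed

lemma matrix_fun_eq_integral:
  assumes "winds_once_around \<Gamma> (spec A)" and "analytic_on_and_inside f \<Gamma>"
  shows "matrix_fun f A = cscale (1 / (2 * pi * \<i>))
    (matrix_contour_integral \<Gamma> (\<lambda>z. cscale (f z) (resolvent A z)))"
  unfolding matrix_fun_def
proof (rule the_equality)
  fix F
  assume "\<exists>\<Gamma>. winds_once_around \<Gamma> (spec A) \<and> analytic_on_and_inside f \<Gamma> \<and>
     F = cscale (1 / (2 * pi * \<i>))
           (matrix_contour_integral \<Gamma> (\<lambda>z. cscale (f z) (resolvent A z)))"
  then show "F = cscale (1 / (2 * pi * \<i>))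
      (matrix_contour_integral \<Gamma> (\<lambda>z. cscale (f z) (resolvent A z)))"
    using assms by (auto simp: matrix_integral_eq_residues)
qed (use assms in blast)

text \<open>The points that a closed path encircles once form an open set, so a small perturbation cannot move
  an eigenvalue out of it.\<close>

lemma eventually_winds_once_around_spec:
  assumes "winds_once_around \<Gamma> (spec A)"
  shows "\<forall>\<^sub>F B in nhds A. winds_once_around \<Gamma> (spec B)"
proof -
  let ?V = "{z. z \<notin> path_image \<Gamma> \<and> winding_number \<Gamma> z = 1}"
  have "open ?V"
    using assms by (intro open_winding_number_levelsets)
      (auto simp: winds_once_around_def valid_path_imp_path)
  moreover have "spec A \<subseteq> ?V"
    using assms by (auto simp: winds_once_around_def)
  ultimately have "\<forall>\<^sub>F B in nhds A. spec B \<subseteq> ?V"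
    by (rule spec_upper_semicontinuous)
  then show ?thesis
    by eventually_elim (use assms in \<open>auto simp: winds_once_around_def\<close>)
qed

section \<open>Uniqueness of Frechet derivatives\<close>

text \<open>The quotient \<open>norm (D H) / norm H\<close> is constant along a ray and tends to 0.\<close>

lemma homogeneous_smallo_imp_zero:
  fixes D :: "'a::real_normed_vector \<Rightarrow> 'b::real_normed_vector"
  assumes hom: "\<And>t X. D (t *\<^sub>R X) = t *\<^sub>R D X"
    and small: "(\<lambda>H. norm (D H)) \<in> o[at 0](norm)"
  shows "D X = 0"
proof (rule ccontr)
  assume nz: "D X \<noteq> 0"
  then have X: "X \<noteq> 0"
    using hom[of 0 0] by auto
  define c where "c = norm (D X) / (2 * norm X)"
  have "c > 0"
    using nz X by (simp add: c_def)
  then have "\<forall>\<^sub>F H in at 0. norm (D H) \<le> c * norm H"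
    using landau_o.smallD[OF small, of c] by simp
  then obtain d where d: "d > 0" "\<And>H. H \<noteq> 0 \<Longrightarrow> norm H < d \<Longrightarrow> norm (D H) \<le> c * norm H"
    by (auto simp: eventually_at)
  define t where "t = d / (2 * norm X)"
  have t: "t > 0"
    using d(1) X by (simp add: t_def)
  have "norm (t *\<^sub>R X) < d"
    using d(1) X by (simp add: t_def)
  then have "norm (D (t *\<^sub>R X)) \<le> c * norm (t *\<^sub>R X)"
    using t X by (intro d(2)) auto
  then have "norm (D X) \<le> norm (D X) / 2"
    using t X by (simp add: hom c_def field_simps)
  then show False
    using nz by simp
qed

lemma multilinear_scaleR:
  assumes "multilinear k L" and "i \<in> {1..k}"
  shows "L (E(i := t *\<^sub>R X)) = t *\<^sub>R L (E(i := X))"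
proof -
  have "Vector_Spaces.linear cscale cscale (\<lambda>X. L (E(i := X)))"
    using assms by (auto simp: multilinear_def)
  then have "L (E(i := cscale (of_real t) X)) = cscale (of_real t) (L (E(i := X)))"
    by (simp add: Vector_Spaces.linear_iff)
  then show ?thesis
    by (simp add: cscale_of_real)
qed

lemma eventually_at_0_shift:
  fixes A :: "'a::real_normed_vector"
  assumes "\<forall>\<^sub>F B in nhds A. P B"
  shows "\<forall>\<^sub>F H in at 0. P (A + H)"
proof -
  have "((\<lambda>H. A + H) \<longlongrightarrow> A + 0) (at 0)"
    by (intro tendsto_intros)
  then have "filterlim (\<lambda>H. A + H) (nhds A) (at 0)"
    by simp
  then show ?thesis
    by (rule eventually_compose_filterlim[OF assms])
qed

text \<open>Two candidates of order \<open>k + 1\<close> come with derivatives of order \<open>k\<close> near \<open>A\<close>, which agree by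
  induction. The difference of the candidates is then linear in the last direction and of smaller order
  than it, hence zero.\<close>

lemma has_frechet_deriv_unique:
  "has_frechet_deriv k F A L \<Longrightarrow> has_frechet_deriv k F A L' \<Longrightarrow> L = L'"
proof (induction k arbitrary: A L L')
  case 0
  then show ?case by simp
next
  case (Suc k)
  obtain G where L: "multilinear (Suc k) L"
    and G: "\<forall>\<^sub>F B in nhds A. has_frechet_deriv k F B (G B)"
    and o: "\<And>E. (\<lambda>H. norm (G (A + H) E - G A E - L (E(Suc k := H)))) \<in> o[at 0](norm)"
    using Suc.prems(1) by auto
  obtain G' where L': "multilinear (Suc k) L'"
    and G': "\<forall>\<^sub>F B in nhds A. has_frechet_deriv k F B (G' B)"
    and o': "\<And>E. (\<lambda>H. norm (G' (A + H) E - G' A E - L' (E(Suc k := H)))) \<in> o[at 0](norm)"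
    using Suc.prems(2) by auto
  have "\<forall>\<^sub>F B in nhds A. G B = G' B"
    using G G' by eventually_elim (rule Suc.IH)
  then have same: "G A = G' A" and same': "\<forall>\<^sub>F H in at 0. G (A + H) = G' (A + H)"
    by (rule eventually_nhds_x_imp_x, rule eventually_at_0_shift)
  show ?case
  proof
    fix E
    define D where "D H = L (E(Suc k := H)) - L' (E(Suc k := H))" for H
    have "(\<lambda>H. norm (D H)) \<in> O[at 0](\<lambda>H. norm (G (A + H) E - G A E - L (E(Suc k := H)))
        + norm (G' (A + H) E - G' A E - L' (E(Suc k := H))))"
    proof (rule bigoI[of _ 1])
      show "\<forall>\<^sub>F H in at 0. norm (norm (D H)) \<le> 1 * norm (norm (G (A + H) E - G A E - L (E(Suc k := H)))
        + norm (G' (A + H) E - G' A E - L' (E(Suc k := H))))"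
        using same'
      proof eventually_elim
        case (elim H)
        have "D H = (G' (A + H) E - G' A E - L' (E(Suc k := H))) - (G (A + H) E - G A E - L (E(Suc k := H)))"
          by (simp add: D_def elim same)
        then have "norm (D H) \<le> norm (G' (A + H) E - G' A E - L' (E(Suc k := H)))
            + norm (G (A + H) E - G A E - L (E(Suc k := H)))"
          by (simp only: norm_triangle_ineq4)
        then show ?case
          by simp
      qed
    qed
    also have "(\<lambda>H. norm (G (A + H) E - G A E - L (E(Suc k := H)))
        + norm (G' (A + H) E - G' A E - L' (E(Suc k := H)))) \<in> o[at 0](norm)"
      by (rule sum_in_smallo(1)[OF o o'])
    finally have small: "(\<lambda>H. norm (D H)) \<in> o[at 0](norm)" .
    have "D (E (Suc k)) = 0"
      by (rule homogeneous_smallo_imp_zero[OF _ small])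
        (simp add: D_def multilinear_scaleR[OF L] multilinear_scaleR[OF L'] algebra_simps)
    then show "L E = L' E"
      by (simp add: D_def)
  qed
qed

section \<open>Sums of resolvent products over permutations\<close>

lemma resolvent_prod_cong:
  "(\<And>i. i \<in> {1..k} \<Longrightarrow> E i = E' i) \<Longrightarrow> resolvent_prod B z E k = resolvent_prod B z E' k"
  by (induction k) auto

lemma resolvent_prod_upd_beyond:
  "k < m \<Longrightarrow> resolvent_prod B z (E(m := X)) k = resolvent_prod B z E k"
  by (rule resolvent_prod_cong) auto

lemma resolvent_prod_add:
  "m \<in> {1..k} \<Longrightarrow> resolvent_prod B z (E(m := X + Y)) k
    = resolvent_prod B z (E(m := X)) k + resolvent_prod B z (E(m := Y)) k"
proof (induction k)
  case (Suc k)
  then show ?case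
    by (cases "m = Suc k") (simp_all add: matrix_mult_add_distribs
        resolvent_prod_upd_beyond[OF lessI] del: fun_upd_apply add: fun_upd_same fun_upd_other)
qed simp

lemma resolvent_prod_cscale:
  "m \<in> {1..k} \<Longrightarrow> resolvent_prod B z (E(m := cscale c X)) k
    = cscale c (resolvent_prod B z (E(m := X)) k)"
proof (induction k)
  case (Suc k)
  then show ?case
    by (cases "m = Suc k") (simp_all add: cscale_mult_left cscale_mult_right
        resolvent_prod_upd_beyond[OF lessI] del: fun_upd_apply add: fun_upd_same fun_upd_other)
qed simp

text \<open>The matrix in argument place \<open>m\<close> stands at position \<open>inv \<pi> m\<close> of the product, so linearity of the
  product in each position gives linearity in each argument.\<close>

lemma M_perm_upd:
  assumes "\<pi> permutes {1..k}"
  shows "M_perm k \<pi> z B (E(m := X)) = resolvent_prod B z ((\<lambda>i. E (\<pi> i))(inv \<pi> m := X)) k"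
proof -
  have "(\<lambda>i. (E(m := X)) (\<pi> i)) = (\<lambda>i. E (\<pi> i))(inv \<pi> m := X)"
    using permutes_inverses[OF assms] by (auto simp: fun_eq_iff)
  then show ?thesis
    by (simp add: M_perm_def)
qed

definition perm_sum ::
  "(complex \<Rightarrow> complex) \<Rightarrow> nat \<Rightarrow> 'n::finite cmatrix \<Rightarrow> (nat \<Rightarrow> 'n cmatrix) \<Rightarrow> complex \<Rightarrow> 'n cmatrix" where
  "perm_sum f k B E z = (\<Sum>\<pi> | \<pi> permutes {1..k}. cscale (f z) (M_perm k \<pi> z B E))"

lemma perm_sum_cong:
  "(\<And>i. i \<in> {1..k} \<Longrightarrow> E i = E' i) \<Longrightarrow> perm_sum f k B E z = perm_sum f k B E' z"
  unfolding perm_sum_def M_perm_def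
  by (intro sum.cong refl arg_cong[where f = "cscale (f z)"] resolvent_prod_cong)
    (metis mem_Collect_eq permutes_in_image)

lemma perm_sum_add:
  assumes "m \<in> {1..k}"
  shows "perm_sum f k B (E(m := X + Y)) z = perm_sum f k B (E(m := X)) z + perm_sum f k B (E(m := Y)) z"
  unfolding perm_sum_def sum.distrib[symmetric]
proof (intro sum.cong refl)
  fix \<pi> assume "\<pi> \<in> {\<pi>. \<pi> permutes {1..k}}"
  then have \<pi>: "\<pi> permutes {1..k}"
    by simp
  then have "inv \<pi> m \<in> {1..k}"
    using assms by (simp only: permutes_in_image[OF permutes_inv])
  with \<pi> show "cscale (f z) (M_perm k \<pi> z B (E(m := X + Y)))
      = cscale (f z) (M_perm k \<pi> z B (E(m := X))) + cscale (f z) (M_perm k \<pi> z B (E(m := Y)))"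
    by (simp only: M_perm_upd resolvent_prod_add cscale_add)
qed

lemma perm_sum_cscale:
  assumes "m \<in> {1..k}"
  shows "perm_sum f k B (E(m := cscale c X)) z = cscale c (perm_sum f k B (E(m := X)) z)"
  unfolding perm_sum_def cscale_sum
proof (intro sum.cong refl)
  fix \<pi> assume "\<pi> \<in> {\<pi>. \<pi> permutes {1..k}}"
  then have \<pi>: "\<pi> permutes {1..k}"
    by simp
  then have "inv \<pi> m \<in> {1..k}"
    using assms by (simp only: permutes_in_image[OF permutes_inv])
  with \<pi> show "cscale (f z) (M_perm k \<pi> z B (E(m := cscale c X)))
      = cscale c (cscale (f z) (M_perm k \<pi> z B (E(m := X))))"
    by (simp only: M_perm_upd resolvent_prod_cscale cscale_cscale mult.commute)
qed

lemma matrix_holomorphic_on_perm_sum: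
  assumes "f holomorphic_on S" and "S \<inter> spec B = {}"
  shows "matrix_holomorphic_on (perm_sum f k B E) S"
proof -
  have "matrix_holomorphic_on (\<lambda>z. \<Sum>\<pi> | \<pi> permutes {1..k}. cscale (f z) (M_perm k \<pi> z B E)) S"
    unfolding M_perm_def using assms
    by (intro matrix_holomorphic_on_sum matrix_holomorphic_on_cscale matrix_holomorphic_on_resolvent_prod)
  then show ?thesis
    by (simp add: perm_sum_def[abs_def])
qed

definition insert_at :: "nat \<Rightarrow> 'a \<Rightarrow> (nat \<Rightarrow> 'a) \<Rightarrow> nat \<Rightarrow> 'a" where
  "insert_at j x E i = (if i < j then E i else if i = j then x else E (i - 1))"

text \<open>The derivative of the product \<open>R E\<^sub>1 R \<dots> E\<^sub>k R\<close> with respect to the matrix, in the direction \<open>H\<close>. The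
  derivative of \<open>R\<close> is \<open>R H R\<close>, so the product rule inserts \<open>H\<close> between the \<open>E\<^sub>i\<close> in all \<open>k + 1\<close> places.\<close>

definition resolvent_prod_deriv ::
  "'n::finite cmatrix \<Rightarrow> complex \<Rightarrow> (nat \<Rightarrow> 'n cmatrix) \<Rightarrow> nat \<Rightarrow> 'n cmatrix \<Rightarrow> 'n cmatrix" where
  "resolvent_prod_deriv B z E k H = (\<Sum>j\<in>{1..Suc k}. resolvent_prod B z (insert_at j H E) (Suc k))"

lemma resolvent_prod_deriv_0:
  "resolvent_prod_deriv B z E 0 H = resolvent B z ** H ** resolvent B z"
  by (simp add: resolvent_prod_deriv_def insert_at_def)

text \<open>The product rule for the last factors \<open>E\<^sub>k\<^sub>+\<^sub>1 R\<close>; the second summand is the insertion of \<open>H\<close> at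
  the very end.\<close>

lemma resolvent_prod_deriv_Suc:
  "resolvent_prod_deriv B z E (Suc k) H = resolvent_prod_deriv B z E k H ** E (Suc k) ** resolvent B z
    + resolvent_prod B z E (Suc k) ** H ** resolvent B z"
proof -
  have "resolvent_prod B z (insert_at j H E) (Suc (Suc k))
      = resolvent_prod B z (insert_at j H E) (Suc k) ** E (Suc k) ** resolvent B z"
    if "j \<in> {1..Suc k}" for j
    using that by (simp add: insert_at_def)
  moreover have "resolvent_prod B z (insert_at (Suc (Suc k)) H E) (Suc (Suc k))
      = resolvent_prod B z E (Suc k) ** H ** resolvent B z"
  proof -
    have "resolvent_prod B z (insert_at (Suc (Suc k)) H E) (Suc k) = resolvent_prod B z E (Suc k)"
      by (rule resolvent_prod_cong) (auto simp: insert_at_def)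
    then show ?thesis
      by (simp add: insert_at_def del: resolvent_prod.simps(2) add: resolvent_prod.simps(2)[of _ _ _ "Suc k"])
  qed
  moreover have "resolvent_prod_deriv B z E (Suc k) H
      = resolvent_prod B z (insert_at (Suc (Suc k)) H E) (Suc (Suc k))
        + (\<Sum>j\<in>{1..Suc k}. resolvent_prod B z (insert_at j H E) (Suc (Suc k)))"
    unfolding resolvent_prod_deriv_def by (rule sum.nat_ivl_Suc') simp
  ultimately show ?thesis
    by (simp only: resolvent_prod_deriv_def[of _ _ _ k] matrix_mult_sum_left add.commute cong: sum.cong)
qed

text \<open>The cyclic permutation of \<open>{j..m}\<close> that carries \<open>j\<close> to \<open>m\<close> and shifts the rest down by one.
  Composing a permutation of \<open>{1..k}\<close> with it, where \<open>m = k + 1\<close>, inserts the value \<open>k + 1\<close> at position \<open>j\<close>.\<close>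

definition rotation :: "nat \<Rightarrow> nat \<Rightarrow> nat \<Rightarrow> nat" where
  "rotation j m i = (if i = j then m else if j < i \<and> i \<le> m then i - 1 else i)"

definition rotation_inv :: "nat \<Rightarrow> nat \<Rightarrow> nat \<Rightarrow> nat" where
  "rotation_inv j m i = (if i = m then j else if j \<le> i \<and> i < m then i + 1 else i)"

lemma rotation_inverse:
  assumes "j \<le> m"
  shows "rotation j m (rotation_inv j m i) = i" and "rotation_inv j m (rotation j m i) = i"
  using assms by (auto simp: rotation_def rotation_inv_def)

lemma permutes_rotation:
  assumes "j \<in> {1..m}"
  shows "rotation j m permutes {1..m}" and "rotation_inv j m permutes {1..m}"
proof -
  have "rotation j m x = x" "rotation_inv j m x = x" if "x \<notin> {1..m}" for x
    using that assms by (auto simp: rotation_def rotation_inv_def)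
  moreover have inverse: "rotation j m (rotation_inv j m y) = y" "rotation_inv j m (rotation j m y) = y" for y
    using rotation_inverse[of j m] assms by auto
  moreover have "\<exists>!x. rotation j m x = y" for y
    using inverse by (intro ex1I[of _ "rotation_inv j m y"]) auto
  moreover have "\<exists>!x. rotation_inv j m x = y" for y
  proof (rule ex1I)
    show "rotation_inv j m (rotation j m y) = y"
      by (rule inverse(2))
    show "x = rotation j m y" if "rotation_inv j m x = y" for x
      using inverse(1)[of x] that by simp
  qed
  ultimately show "rotation j m permutes {1..m}" "rotation_inv j m permutes {1..m}"
    unfolding permutes_def by blast+
qed

text \<open>Every permutation of \<open>{1..k + 1}\<close> arises from exactly one permutation of \<open>{1..k}\<close> by inserting the value
  \<open>k + 1\<close> at exactly one position \<open>j\<close>, namely at its preimage of \<open>k + 1\<close>.\<close>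

lemma sum_permutes_Suc:
  "(\<Sum>\<sigma> | \<sigma> permutes {1..Suc k}. g \<sigma>)
    = (\<Sum>\<pi> | \<pi> permutes {1..k}. \<Sum>j\<in>{1..Suc k}. g (\<pi> \<circ> rotation j (Suc k)))"
proof -
  let ?n = "Suc k"
  have "(\<Sum>\<sigma> | \<sigma> permutes {1..?n}. g \<sigma>)
      = (\<Sum>(\<pi>, j) \<in> {\<pi>. \<pi> permutes {1..k}} \<times> {1..?n}. g (\<pi> \<circ> rotation j ?n))"
  proof (rule sum.reindex_bij_witness[of _ "\<lambda>(\<pi>, j). \<pi> \<circ> rotation j ?n"
        "\<lambda>\<sigma>. (\<sigma> \<circ> rotation_inv (inv \<sigma> ?n) ?n, inv \<sigma> ?n)"])
    fix \<sigma> assume "\<sigma> \<in> {\<sigma>. \<sigma> permutes {1..?n}}"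
    then have \<sigma>: "\<sigma> permutes {1..?n}"
      by simp
    define j where "j = inv \<sigma> ?n"
    have j: "j \<in> {1..?n}" and \<sigma>j: "\<sigma> j = ?n"
      using permutes_in_image[OF permutes_inv[OF \<sigma>], of ?n] permutes_inverses[OF \<sigma>]
      by (auto simp: j_def)
    have eq: "(\<sigma> \<circ> rotation_inv j ?n) \<circ> rotation j ?n = \<sigma>"
      using j by (auto simp: rotation_inverse)
    show "(case (\<sigma> \<circ> rotation_inv (inv \<sigma> ?n) ?n, inv \<sigma> ?n) of (\<pi>, j) \<Rightarrow> \<pi> \<circ> rotation j ?n) = \<sigma>"
      and "(case (\<sigma> \<circ> rotation_inv (inv \<sigma> ?n) ?n, inv \<sigma> ?n) of (\<pi>, j) \<Rightarrow> g (\<pi> \<circ> rotation j ?n)) = g \<sigma>"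
      using eq by (simp_all add: j_def)
    have "\<sigma> \<circ> rotation_inv j ?n permutes {1..?n}"
      using permutes_rotation(2)[OF j] \<sigma> by (rule permutes_compose)
    moreover have "(\<sigma> \<circ> rotation_inv j ?n) x = x" if "x \<in> {1..?n} - {1..k}" for x
    proof -
      have "x = ?n"
        using that by auto
      then show ?thesis
        by (simp add: rotation_inv_def \<sigma>j)
    qed
    ultimately have "\<sigma> \<circ> rotation_inv j ?n permutes {1..k}"
      by (rule permutes_superset)
    then show "(\<sigma> \<circ> rotation_inv (inv \<sigma> ?n) ?n, inv \<sigma> ?n) \<in> {\<pi>. \<pi> permutes {1..k}} \<times> {1..?n}"
      using j by (simp add: j_def)
  next
    fix p assume p: "p \<in> {\<pi>. \<pi> permutes {1..k}} \<times> {1..?n}"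
    obtain \<pi> j where [simp]: "p = (\<pi>, j)" and \<pi>: "\<pi> permutes {1..k}" and j: "j \<in> {1..?n}"
      using p by auto
    have "\<pi> permutes {1..?n}"
      using \<pi> by (rule permutes_subset) auto
    then have perm: "\<pi> \<circ> rotation j ?n permutes {1..?n}"
      using permutes_rotation(1)[OF j] by (intro permutes_compose)
    then show "(case p of (\<pi>, j) \<Rightarrow> \<pi> \<circ> rotation j ?n) \<in> {\<sigma>. \<sigma> permutes {1..?n}}"
      by simp
    have "\<pi> ?n = ?n"
      using \<pi> by (rule permutes_not_in) simp
    then have "(\<pi> \<circ> rotation j ?n) j = ?n"
      by (simp add: rotation_def)
    then have "inv (\<pi> \<circ> rotation j ?n) ?n = j"
      by (rule inv_f_eq[OF permutes_inj[OF perm]])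
    show "((case p of (\<pi>, j) \<Rightarrow> \<pi> \<circ> rotation j ?n)
         \<circ> rotation_inv (inv (case p of (\<pi>, j) \<Rightarrow> \<pi> \<circ> rotation j ?n) ?n) ?n,
        inv (case p of (\<pi>, j) \<Rightarrow> \<pi> \<circ> rotation j ?n) ?n) = p"
      using \<open>inv (\<pi> \<circ> rotation j ?n) ?n = j\<close> j by (auto simp: rotation_inverse fun_eq_iff)
  qed
  then show ?thesis
    by (simp only: sum.cartesian_product)
qed

text \<open>Differentiating the sum of order \<open>k\<close> yields the sum of order \<open>k + 1\<close>: the \<open>k + 1\<close> insertions of \<open>H\<close> into
  each of the \<open>k!\<close> products are the \<open>(k + 1)!\<close> products in which \<open>H\<close> is the new last argument.\<close>

lemma perm_sum_Suc:
  "perm_sum f (Suc k) B (E(Suc k := H)) z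
    = (\<Sum>\<pi> | \<pi> permutes {1..k}. cscale (f z) (resolvent_prod_deriv B z (\<lambda>i. E (\<pi> i)) k H))"
proof -
  have "M_perm (Suc k) (\<pi> \<circ> rotation j (Suc k)) z B (E(Suc k := H))
      = resolvent_prod B z (insert_at j H (\<lambda>i. E (\<pi> i))) (Suc k)"
    if \<pi>: "\<pi> permutes {1..k}" and j: "j \<in> {1..Suc k}" for \<pi> j
    unfolding M_perm_def
  proof (rule resolvent_prod_cong)
    fix i assume i: "i \<in> {1..Suc k}"
    have [simp]: "\<pi> (Suc k) = Suc k"
      using \<pi> by (rule permutes_not_in) simp
    have inj: "\<pi> l = Suc k \<longleftrightarrow> l = Suc k" for l
      using permutes_inj[OF \<pi>] \<open>\<pi> (Suc k) = Suc k\<close> by (metis injD)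
    show "(E(Suc k := H)) ((\<pi> \<circ> rotation j (Suc k)) i) = insert_at j H (\<lambda>i. E (\<pi> i)) i"
      using i j by (auto simp: rotation_def insert_at_def inj)
  qed
  then show ?thesis
    unfolding perm_sum_def sum_permutes_Suc resolvent_prod_deriv_def cscale_sum
    by (intro sum.cong) auto
qed

section \<open>First-order expansion of resolvent products\<close>

text \<open>The second resolvent identity, which drives every estimate below. Substituted into itself, it
  gives the expansion of the resolvent to first order with a quadratic remainder.\<close>

lemma resolvent_diff:
  assumes "z \<notin> spec B" and "z \<notin> spec (B + H)"
  shows "resolvent (B + H) z - resolvent B z = resolvent (B + H) z ** H ** resolvent B z"
proof -
  let ?R = "resolvent B z" and ?R' = "resolvent (B + H) z"
  have right: "(mat z - B) ** ?R = mat 1" and left: "?R' ** (mat z - (B + H)) = mat 1"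
    using assms by (simp_all add: resolvent_def spec_def matrix_inv_right matrix_inv_left)
  have "H = (mat z - B) - (mat z - (B + H))"
    by simp
  then have "?R' ** H ** ?R = ?R' ** ((mat z - B) - (mat z - (B + H))) ** ?R"
    by (rule arg_cong)
  also have "\<dots> = ?R' ** ((mat z - B) ** ?R) - (?R' ** (mat z - (B + H))) ** ?R"
    by (simp only: matrix_mult_diff_left matrix_mult_diff_right matrix_mul_assoc)
  also have "\<dots> = ?R' - ?R"
    unfolding right left by simp
  finally show ?thesis
    by simp
qed

lemma norm_mult3_le:
  fixes X Y Z :: "'n::finite cmatrix"
  assumes "norm X \<le> x" "norm Y \<le> y" "norm Z \<le> z"
  shows "norm (X ** Y ** Z) \<le> x * y * z"
proof -
  have "0 \<le> x" "0 \<le> y"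
    using order_trans[OF norm_ge_zero assms(1)] order_trans[OF norm_ge_zero assms(2)] .
  have "norm (X ** Y) \<le> x * y"
    by (rule order_trans[OF norm_matrix_matrix_mult_le]) (intro mult_mono assms norm_ge_zero \<open>0 \<le> x\<close>)
  then show ?thesis
    by (intro order_trans[OF norm_matrix_matrix_mult_le])
      (intro mult_mono assms norm_ge_zero mult_nonneg_nonneg \<open>0 \<le> x\<close> \<open>0 \<le> y\<close>)
qed

text \<open>For fixed directions \<open>E\<^sub>i\<close> the constant depends on a bound for the resolvents only, and not on \<open>z\<close>,
  \<open>B\<close> or \<open>H\<close>; this uniformity is what lets the estimate pass through the integral.\<close>

lemma resolvent_prod_taylor:
  fixes E :: "nat \<Rightarrow> 'n::finite cmatrix"
  assumes "c \<ge> 0"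
  obtains C where "C \<ge> 0" and "\<And>B H z. z \<notin> spec B \<Longrightarrow> z \<notin> spec (B + H) \<Longrightarrow>
    norm (resolvent B z) \<le> c \<Longrightarrow> norm (resolvent (B + H) z) \<le> c \<Longrightarrow>
    norm (resolvent_prod (B + H) z E k - resolvent_prod B z E k - resolvent_prod_deriv B z E k H)
      \<le> C * (norm H)\<^sup>2"
proof -
  define good where "good B H z \<longleftrightarrow> z \<notin> spec B \<and> z \<notin> spec (B + H) \<and>
    norm (resolvent B z) \<le> c \<and> norm (resolvent (B + H) z) \<le> c" for B H :: "'n cmatrix" and z
  have diff1: "norm (resolvent (B + H) z - resolvent B z) \<le> c\<^sup>2 * norm H"
    and diff2: "norm (resolvent (B + H) z - resolvent B z - resolvent B z ** H ** resolvent B z)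
      \<le> c ^ 3 * (norm H)\<^sup>2" if "good B H z" for B H :: "'n cmatrix" and z
  proof -
    let ?R = "resolvent B z" and ?R' = "resolvent (B + H) z"
    have R: "norm ?R \<le> c" "norm ?R' \<le> c" and d: "?R' - ?R = ?R' ** H ** ?R"
      using that resolvent_diff by (auto simp: good_def)
    have "norm (?R' ** H ** ?R) \<le> c * norm H * c"
      by (intro norm_mult3_le R order_refl)
    then show *: "norm (?R' - ?R) \<le> c\<^sup>2 * norm H"
      by (simp add: d power2_eq_square algebra_simps)
    have "?R' - ?R - ?R ** H ** ?R = (?R' - ?R) ** H ** ?R"
      by (simp only: matrix_mult_diff_left) (simp only: d)
    moreover have "norm ((?R' - ?R) ** H ** ?R) \<le> (c\<^sup>2 * norm H) * norm H * c"
      by (intro norm_mult3_le R * order_refl)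
    moreover have "(c\<^sup>2 * norm H) * norm H * c = c ^ 3 * (norm H)\<^sup>2"
      by (simp add: power2_eq_square power3_eq_cube)
    ultimately show "norm (?R' - ?R - ?R ** H ** ?R) \<le> c ^ 3 * (norm H)\<^sup>2"
      by (simp only:)
  qed
  have "\<exists>C\<ge>0. \<forall>B H z. good B H z \<longrightarrow>
      norm (resolvent_prod B z E k) \<le> C \<and> norm (resolvent_prod_deriv B z E k H) \<le> C * norm H \<and>
      norm (resolvent_prod (B + H) z E k - resolvent_prod B z E k - resolvent_prod_deriv B z E k H)
        \<le> C * (norm H)\<^sup>2"
  proof (induction k)
    case 0
    show ?case
    proof (intro exI[of _ "c + c\<^sup>2 + c ^ 3"] conjI allI impI)
      show "0 \<le> c + c\<^sup>2 + c ^ 3"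
        using assms by simp
      fix B H :: "'n cmatrix" and z assume g: "good B H z"
      then have R: "norm (resolvent B z) \<le> c"
        by (simp add: good_def)
      show "norm (resolvent_prod B z E 0) \<le> c + c\<^sup>2 + c ^ 3"
        using R assms by (simp add: add_increasing2)
      have "norm (resolvent_prod_deriv B z E 0 H) \<le> c * norm H * c"
        unfolding resolvent_prod_deriv_0 by (intro norm_mult3_le R order_refl)
      also have "\<dots> = c\<^sup>2 * norm H"
        by (simp add: power2_eq_square algebra_simps)
      also have "\<dots> \<le> (c + c\<^sup>2 + c ^ 3) * norm H"
        using assms by (intro mult_right_mono) auto
      finally show "norm (resolvent_prod_deriv B z E 0 H) \<le> (c + c\<^sup>2 + c ^ 3) * norm H" .
      have "norm (resolvent_prod (B + H) z E 0 - resolvent_prod B z E 0 - resolvent_prod_deriv B z E 0 H)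
          \<le> c ^ 3 * (norm H)\<^sup>2"
        using diff2[OF g] by (simp add: resolvent_prod_deriv_0)
      also have "\<dots> \<le> (c + c\<^sup>2 + c ^ 3) * (norm H)\<^sup>2"
        using assms by (intro mult_right_mono) auto
      finally show "norm (resolvent_prod (B + H) z E 0 - resolvent_prod B z E 0
          - resolvent_prod_deriv B z E 0 H) \<le> (c + c\<^sup>2 + c ^ 3) * (norm H)\<^sup>2" .
    qed
  next
    case (Suc k)
    then obtain C where C: "C \<ge> 0"
      and T: "\<And>B H z. good B H z \<Longrightarrow> norm (resolvent_prod B z E k) \<le> C"
      and D: "\<And>B H z. good B H z \<Longrightarrow> norm (resolvent_prod_deriv B z E k H) \<le> C * norm H"
      and Q: "\<And>B H z. good B H z \<Longrightarrow> norm (resolvent_prod (B + H) z E k - resolvent_prod B z E k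
          - resolvent_prod_deriv B z E k H) \<le> C * (norm H)\<^sup>2"
      by blast
    let ?e = "norm (E (Suc k))"
    let ?C = "C * ?e * (c + c\<^sup>2 + c ^ 3)"
    show ?case
    proof (intro exI[of _ ?C] conjI allI impI)
      show "0 \<le> ?C"
        using assms C by simp
      fix B H :: "'n cmatrix" and z assume g: "good B H z"
      let ?R = "resolvent B z" and ?R' = "resolvent (B + H) z"
      let ?h = "norm H"
      have R: "norm ?R \<le> c" and R': "norm ?R' \<le> c"
        using g by (simp_all add: good_def)
      have T': "norm (resolvent_prod B z E (Suc k)) \<le> C * ?e * c"
        unfolding resolvent_prod.simps by (intro norm_mult3_le T[OF g] R order_refl)
      also have "\<dots> \<le> ?C"
        using assms C by (intro mult_left_mono) auto
      finally show "norm (resolvent_prod B z E (Suc k)) \<le> ?C" .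
      have "norm (resolvent_prod_deriv B z E (Suc k) H) \<le> (C * ?h) * ?e * c + (C * ?e * c) * ?h * c"
        unfolding resolvent_prod_deriv_Suc
        by (rule norm_triangle_mono) (intro norm_mult3_le D[OF g] T' R order_refl)+
      also have "\<dots> = C * ?e * (c + c\<^sup>2) * ?h"
        by (simp add: power2_eq_square algebra_simps)
      also have "\<dots> \<le> ?C * ?h"
        using assms C by (intro mult_right_mono mult_left_mono) auto
      finally show "norm (resolvent_prod_deriv B z E (Suc k) H) \<le> ?C * ?h" .
      let ?T = "resolvent_prod B z E k" and ?T' = "resolvent_prod (B + H) z E k"
        and ?D = "resolvent_prod_deriv B z E k H" and ?E = "E (Suc k)"
      \<comment> \<open>each summand has one factor that is small to second order, or two of first order\<close>
      have "resolvent_prod (B + H) z E (Suc k) - resolvent_prod B z E (Suc k)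
            - resolvent_prod_deriv B z E (Suc k) H
          = (?T' - ?T - ?D) ** ?E ** ?R' + ?T ** ?E ** (?R' - ?R - ?R ** H ** ?R)
            + ?D ** ?E ** (?R' - ?R)"
        unfolding resolvent_prod_deriv_Suc resolvent_prod.simps
        by (simp only: matrix_mult_diff_left matrix_mult_diff_right matrix_mul_assoc) simp
      also have "norm \<dots> \<le> (C * ?h\<^sup>2) * ?e * c + C * ?e * (c ^ 3 * ?h\<^sup>2) + (C * ?h) * ?e * (c\<^sup>2 * ?h)"
        by (intro norm_triangle_mono norm_mult3_le Q[OF g] T[OF g] D[OF g] R' diff1[OF g] diff2[OF g]
            order_refl)
      also have "\<dots> = ?C * ?h\<^sup>2"
        by (simp add: power2_eq_square algebra_simps)
      finally show "norm (resolvent_prod (B + H) z E (Suc k) - resolvent_prod B z E (Suc k)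
          - resolvent_prod_deriv B z E (Suc k) H) \<le> ?C * ?h\<^sup>2" .
    qed
  qed
  then show ?thesis
    using that unfolding good_def by blast
qed

text \<open>By the tube lemma a closed ball around \<open>B\<close> times \<open>K\<close> lies in the domain of the resolvent, and a
  continuous function is bounded on a compact set.\<close>

lemma resolvent_locally_uniformly_bounded:
  fixes B :: "'n::finite cmatrix"
  assumes "compact K" and "K \<inter> spec B = {}"
  obtains c where "c \<ge> 0" and
    "\<forall>\<^sub>F H in nhds 0. \<forall>z\<in>K. z \<notin> spec (B + H) \<and> norm (resolvent (B + H) z) \<le> c"
proof -
  have "{B} \<times> K \<subseteq> regular_pairs"
    using assms(2) by (auto simp: regular_pairs_iff)
  then have "\<exists>X. B \<in> X \<and> open X \<and> X \<times> K \<subseteq> regular_pairs"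
    by (rule Elementary_Topology.tube_lemma[OF assms(1) open_regular_pairs])
  then obtain X where X: "B \<in> X" "open X" "X \<times> K \<subseteq> regular_pairs"
    by blast
  obtain d where d: "d > 0" "cball B d \<subseteq> X"
    using X open_contains_cball by metis
  have sub: "cball B d \<times> K \<subseteq> regular_pairs"
    using d(2) X(3) by blast
  have "compact ((\<lambda>(B, z). resolvent B z) ` (cball B d \<times> K))"
    by (intro compact_continuous_image compact_Times compact_cball assms(1)
        continuous_on_subset[OF continuous_on_resolvent sub])
  then have "bounded ((\<lambda>(B, z). resolvent B z) ` (cball B d \<times> K))"
    by (rule compact_imp_bounded)
  then obtain c where c: "c > 0"
    and "\<forall>R\<in>(\<lambda>(B, z). resolvent B z) ` (cball B d \<times> K). norm R \<le> c"
    unfolding bounded_pos by blast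
  then have bound: "norm (resolvent B' z) \<le> c" if "B' \<in> cball B d" "z \<in> K" for B' z
    using that by fastforce
  have "\<forall>\<^sub>F H in nhds 0. norm H \<le> d"
    using d(1) by (auto simp: eventually_nhds_metric intro!: exI[of _ d])
  then have "\<forall>\<^sub>F H in nhds 0. \<forall>z\<in>K. z \<notin> spec (B + H) \<and> norm (resolvent (B + H) z) \<le> c"
  proof eventually_elim
    case (elim H)
    then have H: "B + H \<in> cball B d"
      by (simp add: dist_norm)
    then show ?case
      using sub bound[OF H] by (auto simp: subset_iff regular_pairs_iff)
  qed
  then show ?thesis
    using c by (intro that[of c]) auto
qed

lemma compact_neighbourhood:
  fixes P :: "'a::heine_borel set"
  assumes "compact P" "P \<noteq> {}" "open U" "P \<subseteq> U"
  obtains S K where "open S" "compact K" "P \<subseteq> S" "S \<subseteq> K" "K \<subseteq> U"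
proof -
  obtain e where e: "e > 0" "{x. infdist x P \<le> e} \<subseteq> U"
    using compact_in_open_separated assms by metis
  show ?thesis
  proof
    show "open {x. infdist x P < e}"
      by (intro open_Collect_less continuous_intros)
    show "compact {x. infdist x P \<le> e}"
      using compact_infdist_le assms e by blast
    show "P \<subseteq> {x. infdist x P < e}"
      using e by auto
  qed (use e in auto)
qed

section \<open>Differentiation under the integral\<close>

definition perm_integral ::
  "(complex \<Rightarrow> complex) \<Rightarrow> (real \<Rightarrow> complex) \<Rightarrow> nat \<Rightarrow> 'n::finite cmatrix \<Rightarrow> (nat \<Rightarrow> 'n cmatrix) \<Rightarrow> 'n cmatrix"
  where "perm_integral f \<Gamma> k B E =
    cscale (1 / (2 * pi * \<i>)) (matrix_contour_integral \<Gamma> (perm_sum f k B E))"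

text \<open>The estimates need two sets around the contour: an open one, on which integrands are holomorphic
  and integrals can be bounded, inside a compact one, on which resolvents and \<open>f\<close> are bounded.\<close>

lemma compact_strip:
  fixes B :: "'n::finite cmatrix"
  assumes "winds_once_around \<Gamma> (spec B)" and "analytic_on_and_inside f \<Gamma>"
  obtains S K where "open S" "compact K" "path_image \<Gamma> \<subseteq> S" "S \<subseteq> K" "K \<inter> spec B = {}"
    "f holomorphic_on K"
proof -
  have \<Gamma>: "path \<Gamma>" "path_image \<Gamma> \<inter> spec B = {}"
    using assms(1) by (auto simp: winds_once_around_def valid_path_imp_path)
  obtain W where W: "open W" "path_image \<Gamma> \<subseteq> W" "f holomorphic_on W"
    using assms(2) unfolding analytic_on_and_inside_def analytic_on_holomorphic by blast
  obtain S K where SK: "open S" "compact K" "path_image \<Gamma> \<subseteq> S" "S \<subseteq> K" "K \<subseteq> W - spec B"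
  proof (rule compact_neighbourhood)
    show "compact (path_image \<Gamma>)" "path_image \<Gamma> \<noteq> {}"
      using \<Gamma>(1) by (auto intro: compact_path_image)
    show "open (W - spec B)" "path_image \<Gamma> \<subseteq> W - spec B"
      using W \<Gamma>(2) by (auto intro: open_Diff closed_spec)
  qed
  have "f holomorphic_on K"
    by (rule holomorphic_on_subset[OF W(3)]) (use SK(5) in auto)
  with SK show ?thesis
    by (intro that[of S K]) auto
qed

lemma multilinear_perm_integral:
  assumes \<Gamma>: "winds_once_around \<Gamma> (spec B)" and f: "analytic_on_and_inside f \<Gamma>"
  shows "multilinear k (perm_integral f \<Gamma> k B)"
proof -
  obtain S K where SK: "open S" "path_image \<Gamma> \<subseteq> S" "S \<subseteq> K" "K \<inter> spec B = {}" "f holomorphic_on K"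
    by (rule compact_strip[OF \<Gamma> f])
  have "valid_path \<Gamma>"
    using \<Gamma> by (simp add: winds_once_around_def)
  have hol: "matrix_holomorphic_on (perm_sum f k B E) S" for E
    by (intro matrix_holomorphic_on_perm_sum holomorphic_on_subset[OF SK(5,3)]) (use SK in blast)
  note integral = \<open>valid_path \<Gamma>\<close> SK(2,1) hol
  show ?thesis
    unfolding multilinear_def
  proof (intro conjI allI impI ballI linear_cscaleI)
    fix E E' :: "nat \<Rightarrow> 'a cmatrix" assume "\<forall>i\<in>{1..k}. E i = E' i"
    then have "perm_sum f k B E = perm_sum f k B E'"
      by (intro ext perm_sum_cong) blast
    then show "perm_integral f \<Gamma> k B E = perm_integral f \<Gamma> k B E'"
      by (simp add: perm_integral_def)
  next
    fix m E X Y assume m: "m \<in> {1..k}"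
    then have "perm_sum f k B (E(m := X + Y))
        = (\<lambda>z. perm_sum f k B (E(m := X)) z + perm_sum f k B (E(m := Y)) z)"
      by (intro ext perm_sum_add)
    then show "perm_integral f \<Gamma> k B (E(m := X + Y))
        = perm_integral f \<Gamma> k B (E(m := X)) + perm_integral f \<Gamma> k B (E(m := Y))"
      by (simp only: perm_integral_def matrix_contour_integral_add[OF integral hol] cscale_add)
  next
    fix m E c X assume m: "m \<in> {1..k}"
    then have "perm_sum f k B (E(m := cscale c X)) = (\<lambda>z. cscale c (perm_sum f k B (E(m := X)) z))"
      by (intro ext perm_sum_cscale)
    then show "perm_integral f \<Gamma> k B (E(m := cscale c X)) = cscale c (perm_integral f \<Gamma> k B (E(m := X)))"
      by (simp only: perm_integral_def matrix_contour_integral_cscale[OF integral] cscale_cscale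
          mult.commute)
  qed
qed

text \<open>The remainder at order \<open>k\<close> is the integral of \<open>f\<close> times a sum of remainders of resolvent
  products, which are quadratic in \<open>H\<close> uniformly along the contour.\<close>

lemma perm_integral_step:
  assumes \<Gamma>: "winds_once_around \<Gamma> (spec B)" and f: "analytic_on_and_inside f \<Gamma>"
  shows "(\<lambda>H. norm (perm_integral f \<Gamma> k (B + H) E - perm_integral f \<Gamma> k B E
      - perm_integral f \<Gamma> (Suc k) B (E(Suc k := H)))) \<in> o[at 0](norm)"
proof -
  obtain S K where SK: "open S" "compact K" "path_image \<Gamma> \<subseteq> S" "S \<subseteq> K" "K \<inter> spec B = {}"
      "f holomorphic_on K"
    by (rule compact_strip[OF \<Gamma> f])
  have valid: "valid_path \<Gamma>"
    using \<Gamma> by (simp add: winds_once_around_def)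
  have fS: "f holomorphic_on S"
    by (rule holomorphic_on_subset[OF SK(6,4)])
  obtain m where m: "m > 0" "\<And>z. z \<in> K \<Longrightarrow> cmod (f z) \<le> m"
    using compact_imp_bounded[OF compact_continuous_image[OF holomorphic_on_imp_continuous_on[OF SK(6)] SK(2)]]
    unfolding bounded_pos by blast
  obtain c where c: "c \<ge> 0" and near:
    "\<forall>\<^sub>F H in nhds 0. \<forall>z\<in>K. z \<notin> spec (B + H) \<and> norm (resolvent (B + H) z) \<le> c"
    by (rule resolvent_locally_uniformly_bounded[OF SK(2,5)])
  have at_B: "norm (resolvent B z) \<le> c" if "z \<in> K" for z
    using eventually_nhds_x_imp_x[OF near] that by simp
  let ?Rem = "\<lambda>\<pi> H z. resolvent_prod (B + H) z (\<lambda>i. E (\<pi> i)) k - resolvent_prod B z (\<lambda>i. E (\<pi> i)) k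
      - resolvent_prod_deriv B z (\<lambda>i. E (\<pi> i)) k H"
  have "\<exists>C\<ge>0. \<forall>H z. z \<notin> spec B \<longrightarrow> z \<notin> spec (B + H) \<longrightarrow> norm (resolvent B z) \<le> c \<longrightarrow>
      norm (resolvent (B + H) z) \<le> c \<longrightarrow> norm (?Rem \<pi> H z) \<le> C * (norm H)\<^sup>2" for \<pi>
    by (rule resolvent_prod_taylor[OF c, of "\<lambda>i. E (\<pi> i)" k]) blast
  then obtain C where C: "\<And>\<pi>. C \<pi> \<ge> 0" and Rem: "\<And>\<pi> H z. z \<notin> spec B \<Longrightarrow> z \<notin> spec (B + H) \<Longrightarrow>
      norm (resolvent B z) \<le> c \<Longrightarrow> norm (resolvent (B + H) z) \<le> c \<Longrightarrow>
      norm (?Rem \<pi> H z) \<le> C \<pi> * (norm H)\<^sup>2"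
    by metis
  obtain L where L: "L > 0" and bound: "\<And>(F :: complex \<Rightarrow> 'a cmatrix) b. matrix_holomorphic_on F S
          \<Longrightarrow> (\<And>z. z \<in> S \<Longrightarrow> norm (F z) \<le> b) \<Longrightarrow> norm (matrix_contour_integral \<Gamma> F) \<le> L * b"
    by (rule matrix_contour_integral_bound[OF valid SK(3,1)]) blast
  define M where "M = cmod (1 / (2 * pi * \<i>)) * (L * (\<Sum>\<pi> | \<pi> permutes {1..k}. m * C \<pi>))"
  have "M \<ge> 0"
    unfolding M_def using L C m by (intro mult_nonneg_nonneg sum_nonneg) (auto intro: less_imp_le)
  let ?diff = "\<lambda>H. perm_integral f \<Gamma> k (B + H) E - perm_integral f \<Gamma> k B E
      - perm_integral f \<Gamma> (Suc k) B (E(Suc k := H))"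
  have quadratic: "\<forall>\<^sub>F H in at 0. norm (?diff H) \<le> M * (norm H)\<^sup>2"
  proof -
    have "\<forall>\<^sub>F H in at 0. \<forall>z\<in>K. z \<notin> spec (B + H) \<and> norm (resolvent (B + H) z) \<le> c"
      using near by (simp add: eventually_nhds_conv_at)
    then show ?thesis
    proof eventually_elim
      case (elim H)
      let ?F = "\<lambda>z. perm_sum f k (B + H) E z - perm_sum f k B E z - perm_sum f (Suc k) B (E(Suc k := H)) z"
      have disj: "S \<inter> spec (B + H) = {}" "S \<inter> spec B = {}"
        using elim SK by auto
      note hol = matrix_holomorphic_on_perm_sum[OF fS disj(1)] matrix_holomorphic_on_perm_sum[OF fS disj(2)]
      have F: "matrix_holomorphic_on ?F S"
        by (intro matrix_holomorphic_on_diff hol)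
      have "?diff H = cscale (1 / (2 * pi * \<i>)) (matrix_contour_integral \<Gamma> ?F)"
        unfolding perm_integral_def cscale_diff[symmetric]
        by (simp only: matrix_contour_integral_diff[OF valid SK(3,1)] hol matrix_holomorphic_on_diff)
      moreover have "norm (?F z) \<le> (\<Sum>\<pi> | \<pi> permutes {1..k}. m * C \<pi>) * (norm H)\<^sup>2" if "z \<in> S" for z
      proof -
        have z: "z \<in> K" "z \<notin> spec B" "z \<notin> spec (B + H)"
          using that SK elim by auto
        have "?F z = (\<Sum>\<pi> | \<pi> permutes {1..k}. cscale (f z) (?Rem \<pi> H z))"
          unfolding perm_sum_Suc by (simp only: perm_sum_def M_perm_def cscale_diff sum_subtractf)
        also have "norm \<dots> \<le> (\<Sum>\<pi> | \<pi> permutes {1..k}. m * (C \<pi> * (norm H)\<^sup>2))"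
        proof (intro order_trans[OF norm_sum] sum_mono)
          fix \<pi>
          have "norm (?Rem \<pi> H z) \<le> C \<pi> * (norm H)\<^sup>2"
            using z at_B elim by (intro Rem) auto
          with m(1) m(2)[OF z(1)] show "norm (cscale (f z) (?Rem \<pi> H z)) \<le> m * (C \<pi> * (norm H)\<^sup>2)"
            unfolding norm_cscale by (intro mult_mono) auto
        qed
        also have "\<dots> = (\<Sum>\<pi> | \<pi> permutes {1..k}. m * C \<pi>) * (norm H)\<^sup>2"
          by (simp add: sum_distrib_right mult.assoc)
        finally show ?thesis .
      qed
      ultimately have "norm (?diff H) \<le> cmod (1 / (2 * pi * \<i>))
          * (L * ((\<Sum>\<pi> | \<pi> permutes {1..k}. m * C \<pi>) * (norm H)\<^sup>2))"
        using bound[OF F] by (simp only: norm_cscale) (intro mult_left_mono, auto)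
      then show ?case
        by (simp add: M_def mult.assoc)
    qed
  qed
  show ?thesis
  proof (rule landau_o.smallI)
    fix e :: real assume e: "e > 0"
    have "\<forall>\<^sub>F H in at (0 :: 'a cmatrix). norm H < e / (M + 1)"
      using e \<open>M \<ge> 0\<close> by (auto simp: eventually_at intro!: exI[of _ "e / (M + 1)"])
    with quadratic show "\<forall>\<^sub>F H in at 0. norm (norm (?diff H)) \<le> e * norm (norm H)"
    proof eventually_elim
      case (elim H)
      have "M * norm H \<le> (M + 1) * norm H"
        by (simp add: mult_right_mono)
      also have "\<dots> \<le> e"
        using elim(2) \<open>M \<ge> 0\<close> by (simp add: field_simps)
      finally have "M * norm H * norm H \<le> e * norm H"
        by (rule mult_right_mono) simp
      with elim(1) show ?case
        by (simp add: power2_eq_square mult.assoc)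
    qed
  qed
qed

text \<open>The induction runs over all matrices whose spectrum is encircled once by the fixed contour. They
  form a neighbourhood of each of their members, as the definition of higher derivatives requires.\<close>

lemma has_frechet_deriv_matrix_fun:
  assumes "winds_once_around \<Gamma> (spec B)" and f: "analytic_on_and_inside f \<Gamma>"
  shows "has_frechet_deriv k (matrix_fun f) B (perm_integral f \<Gamma> k B)"
  using assms(1)
proof (induction k arbitrary: B)
  case 0
  have "{\<pi>. \<pi> permutes {1..0::nat}} = {id}"
    by simp
  then have "perm_sum f 0 B E = (\<lambda>z. cscale (f z) (resolvent B z))" for E
    unfolding perm_sum_def M_perm_def by (intro ext) (simp only:, simp)
  then show ?case
    using matrix_fun_eq_integral[OF 0 f] by (simp add: perm_integral_def[abs_def])
next
  case (Suc k)
  have "\<forall>\<^sub>F B' in nhds B. has_frechet_deriv k (matrix_fun f) B' (perm_integral f \<Gamma> k B')"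
    using eventually_winds_once_around_spec[OF Suc.prems] by eventually_elim (rule Suc.IH)
  then show ?case
    using multilinear_perm_integral[OF Suc.prems f] perm_integral_step[OF Suc.prems f]
    by (auto intro!: exI[of _ "perm_integral f \<Gamma> k"])
qed

text \<open>Existence of the derivative is part of the claim, since a description operator alone would also
  denote something where there is no derivative.\<close>

theorem theorem2:
  fixes A :: "complex ^ 'n ^ 'n" and E :: "nat \<Rightarrow> complex ^ 'n ^ 'n"
    and f :: "complex \<Rightarrow> complex" and \<Gamma> :: "real \<Rightarrow> complex" and k :: nat
  assumes "k \<ge> 1"
    and "winds_once_around \<Gamma> (spec A)"
    and "analytic_on_and_inside f \<Gamma>"
  shows "(\<exists>L. has_frechet_deriv k (matrix_fun f) A L) \<and>
    frechet_deriv k (matrix_fun f) A E =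
      cscale (1 / (2 * pi * \<i>))
        (matrix_contour_integral \<Gamma>
          (\<lambda>\<zeta>. \<Sum>\<pi> | \<pi> permutes {1..k}. cscale (f \<zeta>) (M_perm k \<pi> \<zeta> A E)))"
proof -
  have deriv: "has_frechet_deriv k (matrix_fun f) A (perm_integral f \<Gamma> k A)"
    by (rule has_frechet_deriv_matrix_fun[OF assms(2,3)])
  then have "frechet_deriv k (matrix_fun f) A = perm_integral f \<Gamma> k A"
    unfolding frechet_deriv_def by (intro the_equality has_frechet_deriv_unique)
  with deriv show ?thesis
    by (auto simp: perm_integral_def perm_sum_def[abs_def])
qed

end
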